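(* Let $-\infty<a<b<\infty$ and $m\ge1$, and suppose that $c_1,\ldots,c_m$ are the first $m$ terms (with indices $1,\dots,m$) of an admissible sequence for $[a,b]$. Then for every integer $k\ge0$, $$M_m^+(k;c_{1:m}):=\sup_{\mu\in\mathcal{F}_m(c_{1:m})}\int_{[a,b]}\frac{(b-t)^k}{k!}\,\mu(dt)\qquad\text{and}\qquad M_m^-(k;c_{1:m}):=\inf_{\mu\in\mathcal{F}_m(c_{1:m})}\int_{[a,b]}\frac{(b-t)^k}{k!}\,\mu(dt)$$ are each attained by a measure in $\mathcal{F}_m(c_{1:m})$ supported on at most $m+1$ points. Equivalently, if $X$ is any random variable on $[a,b]$ with given moments $\mathbb{E}[X^k]$ for $k=1,\ldots,m$, then for any polynomial $p$ (of any degree $r$) the sharp upper and lower bounds on $\mathbb{E}[p(X)]$ (the supremum and infimum of $\mathbb{E}[p(X)]$ over all $[a,b]$-valued random variables $X$ with these given first $m$ moments) are attained by discrete random variables with these moments supported on at most $m+1$ points of $[a,b]$.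
   Context: $\mathcal{P}_{[a,b]}$ denotes the set of Borel probability measures on $[a,b]$. A real sequence $\{\varepsilon_n\}_{n\ge0}$ is admissible for $[a,b]$ if there is $\mu\in\mathcal{P}_{[a,b]}$ with $\varepsilon_n=\frac1{n!}\int_{[a,b]}(b-x)^n\,\mu(dx)$ for all $n\ge0$ (with $0^0=1$). For $c_{1:m}=(c_1,\dots,c_m)\in\mathbb{R}^m$, $$\mathcal{F}_m(c_{1:m}):=\left\{\mu\in\mathcal{P}_{[a,b]}:\frac1{j!}\int_{[a,b]}(b-t)^j\,\mu(dt)=c_j\text{ for }j=1,\ldots,m\right\}.$$ In the second formulation the given moments are assumed to be those of at least one $[a,b]$-valued random variable. *)

theory Defs
  imports "HOL-Probability.Probability" "HOL-Computational_Algebra.Polynomial"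
begin

definition prob_on :: "real \<Rightarrow> real \<Rightarrow> real measure set" where
  "prob_on a b = {\<mu>. prob_space \<mu> \<and> sets \<mu> = sets (restrict_space borel {a..b})}"

definition admissible :: "real \<Rightarrow> real \<Rightarrow> (nat \<Rightarrow> real) \<Rightarrow> bool" where
  "admissible a b \<epsilon> \<longleftrightarrow>
     (\<exists>\<mu>\<in>prob_on a b. \<forall>n. \<epsilon> n = 1 / fact n * (\<integral>x. (b - x) ^ n \<partial>\<mu>))"

text \<open>The vector \<open>c\<^sub>1, \<dots>, c\<^sub>m\<close> is encoded as a function of which only the values at
  \<open>1, \<dots>, m\<close> are used.\<close>

definition moment_class :: "real \<Rightarrow> real \<Rightarrow> nat \<Rightarrow> (nat \<Rightarrow> real) \<Rightarrow> real measure set" where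
  "moment_class a b m c =
     {\<mu> \<in> prob_on a b. \<forall>j\<in>{1..m}. 1 / fact j * (\<integral>t. (b - t) ^ j \<partial>\<mu>) = c j}"

text \<open>\<open>SUP\<close> and \<open>INF\<close> below are taken in the conditionally complete order \<open>real\<close>. They have
  their usual meaning whenever the class they range over is nonempty, because the
  integrands are bounded on the compact interval.\<close>

definition M_plus :: "real \<Rightarrow> real \<Rightarrow> nat \<Rightarrow> nat \<Rightarrow> (nat \<Rightarrow> real) \<Rightarrow> real" where
  "M_plus a b m k c = (SUP \<mu>\<in>moment_class a b m c. \<integral>t. (b - t) ^ k / fact k \<partial>\<mu>)"

definition M_minus :: "real \<Rightarrow> real \<Rightarrow> nat \<Rightarrow> nat \<Rightarrow> (nat \<Rightarrow> real) \<Rightarrow> real" where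
  "M_minus a b m k c = (INF \<mu>\<in>moment_class a b m c. \<integral>t. (b - t) ^ k / fact k \<partial>\<mu>)"

definition supported_on_at_most :: "nat \<Rightarrow> real measure \<Rightarrow> bool" where
  "supported_on_at_most n \<mu> \<longleftrightarrow>
     (\<exists>S. S \<subseteq> space \<mu> \<and> finite S \<and> card S \<le> n \<and> measure \<mu> S = 1)"

text \<open>A random variable is a pair of a probability space and a measurable map on it.\<close>

definition moment_rvs ::
    "real \<Rightarrow> real \<Rightarrow> nat \<Rightarrow> (nat \<Rightarrow> real) \<Rightarrow> ('w measure \<times> ('w \<Rightarrow> real)) set" where
  "moment_rvs a b m q =
     {(\<Omega>, X). prob_space \<Omega> \<and> X \<in> \<Omega> \<rightarrow>\<^sub>M restrict_space borel {a..b} \<and>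
        (\<forall>j\<in>{1..m}. (\<integral>\<omega>. X \<omega> ^ j \<partial>\<Omega>) = q j)}"

text \<open>A set of random variables must have a fixed sample type. Sample type \<open>real\<close> loses
  nothing: a random variable on any probability space has the same expectations as the
  identity under its distribution, and that distribution is a \<open>real measure\<close>.\<close>

definition upper_expectation ::
    "real \<Rightarrow> real \<Rightarrow> nat \<Rightarrow> (nat \<Rightarrow> real) \<Rightarrow> real poly \<Rightarrow> real" where
  "upper_expectation a b m q p =
     (SUP (\<Omega>, X)\<in>(moment_rvs a b m q :: (real measure \<times> (real \<Rightarrow> real)) set).
        \<integral>\<omega>. poly p (X \<omega>) \<partial>\<Omega>)"

definition lower_expectation ::
    "real \<Rightarrow> real \<Rightarrow> nat \<Rightarrow> (nat \<Rightarrow> real) \<Rightarrow> real poly \<Rightarrow> real" where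
  "lower_expectation a b m q p =
     (INF (\<Omega>, X)\<in>(moment_rvs a b m q :: (real measure \<times> (real \<Rightarrow> real)) set).
        \<integral>\<omega>. poly p (X \<omega>) \<partial>\<Omega>)"

definition discrete_rv_at_most ::
    "real \<Rightarrow> real \<Rightarrow> nat \<Rightarrow> 'w measure \<Rightarrow> ('w \<Rightarrow> real) \<Rightarrow> bool" where
  "discrete_rv_at_most a b n \<Omega> X \<longleftrightarrow>
     supported_on_at_most n (distr \<Omega> (restrict_space borel {a..b}) X)"

end

theory Submission
  imports Defs
begin

text \<open>Rounding a measure to a grid gives finitely supported measures whose integrals of the
  constraint functions and of the objective are arbitrarily close to the original ones. If such a
  measure has more than \<open>m + 1\<close> atoms, the total mass and the \<open>m\<close> constraint integrals are
  linearly dependent on the atoms, so mass can be moved along a kernel direction that does not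
  decrease the objective until an atom disappears. Hence a maximizing sequence can be taken with
  at most \<open>m + 1\<close> atoms each, and compactness of the atoms and of the weights yields a limit that
  satisfies the constraints exactly and attains the supremum.\<close>

section \<open>Linear algebra: kernel directions and reduction of the number of atoms\<close>

text \<open>Gaussian elimination, one equation at a time: a nonzero coefficient in row
  \<open>n\<close> serves as pivot and removes one unknown together with that row, so the surplus of
  unknowns over equations survives the induction.\<close>

lemma homogeneous_system_nontrivial:
  fixes A :: "nat \<Rightarrow> 'i \<Rightarrow> real"
  assumes "finite S" "card S > n"
  shows "\<exists>d. (\<exists>i\<in>S. d i \<noteq> 0) \<and> (\<forall>j<n. (\<Sum>i\<in>S. d i * A j i) = 0)"
  using assms
proof (induction n arbitrary: S A)
  case 0
  then have "S \<noteq> {}" by auto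
  then show ?case by (intro exI[of _ "\<lambda>_. 1"]) auto
next
  case (Suc n)
  show ?case
  proof (cases "\<forall>i\<in>S. A n i = 0")
    case True
    from Suc.IH[of S A] Suc.prems obtain d
      where "\<exists>i\<in>S. d i \<noteq> 0" "\<forall>j<n. (\<Sum>i\<in>S. d i * A j i) = 0" by auto
    then show ?thesis using True by (intro exI[of _ d]) (auto simp: less_Suc_eq)
  next
    case False
    then obtain k where k: "k \<in> S" "A n k \<noteq> 0" by auto
    define T where "T = S - {k}"
    have T: "finite T" "card T > n" "k \<notin> T" and S: "S = insert k T"
      using Suc.prems k by (auto simp: T_def)
    \<comment> \<open>Row \<open>n\<close> determines unknown \<open>k\<close> from the others;
      substituting this into row \<open>j\<close> produces the coefficients below.\<close>
    obtain d where d: "\<exists>i\<in>T. d i \<noteq> 0"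
      "\<forall>j<n. (\<Sum>i\<in>T. d i * (A j i - A j k * A n i / A n k)) = 0"
      using Suc.IH[of T "\<lambda>j i. A j i - A j k * A n i / A n k"] T by blast
    define s where "s = (\<Sum>i\<in>T. d i * A n i)"
    \<comment> \<open>Back substitution: this value of unknown \<open>k\<close> is the one that
      makes row \<open>n\<close> vanish.\<close>
    define d' where "d' = d(k := - s / A n k)"
    have eq: "(\<Sum>i\<in>S. d' i * A j i) = (\<Sum>i\<in>T. d i * A j i) - s * A j k / A n k" for j
    proof -
      have "(\<Sum>i\<in>T. d' i * A j i) = (\<Sum>i\<in>T. d i * A j i)"
        using T by (intro sum.cong) (auto simp: d'_def)
      then show ?thesis using T by (simp add: S d'_def)
    qed
    have "(\<Sum>i\<in>S. d' i * A j i) = 0" if "j < Suc n" for j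
    proof (cases "j = n")
      case True
      then show ?thesis using k by (simp add: eq s_def)
    next
      case False
      then have "j < n" using that by simp
      then have "(\<Sum>i\<in>T. d i * (A j i - A j k * A n i / A n k)) = 0" using d by blast
      moreover have "(\<Sum>i\<in>T. d i * (A j i - A j k * A n i / A n k)) =
          (\<Sum>i\<in>T. d i * A j i) - s * A j k / A n k"
      proof -
        have "(\<Sum>i\<in>T. d i * (A j i - A j k * A n i / A n k)) =
            (\<Sum>i\<in>T. d i * A j i - A j k / A n k * (d i * A n i))"
          by (intro sum.cong) (simp_all add: right_diff_distrib)
        then show ?thesis
          by (simp only: sum_subtractf sum_distrib_left[symmetric]) (simp add: s_def)
      qed
      ultimately show ?thesis by (simp add: eq)
    qed
    moreover have "\<exists>i\<in>S. d' i \<noteq> 0" using d(1) T(3) by (auto simp: S d'_def)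
    ultimately show ?thesis by blast
  qed
qed

text \<open>The constant row \<open>A p\<close> makes every kernel direction have a negative entry; without it the
  objective could increase forever along a nonnegative direction.\<close>
lemma reduce_support:
  fixes A :: "nat \<Rightarrow> 'i \<Rightarrow> real" and w f :: "'i \<Rightarrow> real"
  assumes I: "finite I" and w: "\<forall>i\<in>I. w i \<ge> 0" and p: "p < n" "\<forall>i\<in>I. A p i = 1"
  shows "\<exists>w'. (\<forall>i\<in>I. w' i \<ge> 0) \<and> card {i\<in>I. w' i \<noteq> 0} \<le> n \<and>
    (\<forall>j<n. (\<Sum>i\<in>I. w' i * A j i) = (\<Sum>i\<in>I. w i * A j i)) \<and>
    (\<Sum>i\<in>I. w i * f i) \<le> (\<Sum>i\<in>I. w' i * f i)"
  using w
proof (induction "card {i\<in>I. w i \<noteq> 0}" arbitrary: w rule: less_induct)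
  case less
  define S where "S = {i\<in>I. w i \<noteq> 0}"
  have S: "finite S" "S \<subseteq> I" "\<And>i. i \<in> S \<Longrightarrow> w i > 0"
    using I less.prems by (force simp: S_def)+
  show ?case
  proof (cases "card S \<le> n")
    case True
    then show ?thesis using less.prems by (intro exI[of _ w]) (auto simp: S_def)
  next
    case False
    then obtain d0 where d0: "\<exists>i\<in>S. d0 i \<noteq> 0" "\<forall>j<n. (\<Sum>i\<in>S. d0 i * A j i) = 0"
      using homogeneous_system_nontrivial[of S n A] S by (auto simp: not_le)
    \<comment> \<open>The kernel is closed under negation, so the direction can be oriented to keep
      the objective from decreasing.\<close>
    define d where "d = (if (\<Sum>i\<in>S. d0 i * f i) \<ge> 0 then d0 else (\<lambda>i. - d0 i))"
    have d: "\<exists>i\<in>S. d i \<noteq> 0" "\<forall>j<n. (\<Sum>i\<in>S. d i * A j i) = 0" "(\<Sum>i\<in>S. d i * f i) \<ge> 0"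
      using d0 by (auto simp: d_def sum_negf)
    have "(\<Sum>i\<in>S. d i) = (\<Sum>i\<in>S. d i * A p i)"
      using p S by (intro sum.cong) auto
    then have sum0: "(\<Sum>i\<in>S. d i) = 0" using d p by simp
    have ex: "\<exists>i\<in>S. d i < 0"
    proof (rule ccontr)
      assume "\<not> ?thesis"
      then have "\<forall>i\<in>S. d i = 0"
        using sum_nonneg_eq_0_iff[of S d] S sum0 by (auto simp: not_less)
      then show False using d(1) by auto
    qed
    define N where "N = {i\<in>S. d i < 0}"
    \<comment> \<open>The largest step along \<open>d\<close> that keeps all weights nonnegative.
      Only entries with \<open>d i < 0\<close> restrict it, and an index \<open>k\<close> attaining
      the minimum loses its whole weight.\<close>
    define t where "t = Min ((\<lambda>i. w i / - d i) ` N)"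
    have N: "finite N" "N \<noteq> {}" "N \<subseteq> S" using S ex by (auto simp: N_def)
    have "t \<in> (\<lambda>i. w i / - d i) ` N" unfolding t_def using N by (intro Min_in) auto
    then obtain k where k: "k \<in> N" "t = w k / - d k" by auto
    have t_le: "t \<le> w i / - d i" if "i \<in> N" for i
      unfolding t_def using N that by (intro Min_le) auto
    have dk: "k \<in> S" "d k < 0" using k by (auto simp: N_def)
    have t0: "t > 0" using S(3)[OF dk(1)] dk k by (simp add: divide_neg_neg divide_pos_neg)
    define u where "u = (\<lambda>i. if i \<in> S then w i + t * d i else 0)"
    have sum_u: "(\<Sum>i\<in>I. u i * g i) = (\<Sum>i\<in>I. w i * g i) + t * (\<Sum>i\<in>S. d i * g i)" for g
    proof -
      have "(\<Sum>i\<in>I. u i * g i) = (\<Sum>i\<in>S. u i * g i)"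
        using I S by (intro sum.mono_neutral_right) (auto simp: u_def)
      also have "\<dots> = (\<Sum>i\<in>S. w i * g i) + t * (\<Sum>i\<in>S. d i * g i)"
        by (simp add: u_def algebra_simps sum.distrib sum_distrib_left)
      also have "(\<Sum>i\<in>S. w i * g i) = (\<Sum>i\<in>I. w i * g i)"
        using I S by (intro sum.mono_neutral_left) (auto simp: S_def)
      finally show ?thesis .
    qed
    have u_nonneg: "u i \<ge> 0" for i
    proof (cases "i \<in> N")
      case True
      then have "i \<in> S" "d i < 0" by (auto simp: N_def)
      with t_le[OF True] show ?thesis by (simp add: u_def field_simps)
    next
      case False
      then show ?thesis using S(3)[of i] t0 by (auto simp: u_def N_def)
    qed
    \<comment> \<open>Index \<open>k\<close> leaves the support and no index enters it, so the
      induction on the support size applies to \<open>u\<close>.\<close>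
    have "u k = 0" using dk k by (simp add: u_def)
    then have "{i\<in>I. u i \<noteq> 0} \<subset> S" using dk by (auto simp: u_def split: if_splits)
    then have "card {i\<in>I. u i \<noteq> 0} < card {i\<in>I. w i \<noteq> 0}"
      using S(1) psubset_card_mono unfolding S_def by blast
    from less.hyps[OF this] u_nonneg obtain w' where w': "\<forall>i\<in>I. w' i \<ge> 0"
      "card {i\<in>I. w' i \<noteq> 0} \<le> n"
      "\<forall>j<n. (\<Sum>i\<in>I. w' i * A j i) = (\<Sum>i\<in>I. u i * A j i)"
      "(\<Sum>i\<in>I. u i * f i) \<le> (\<Sum>i\<in>I. w' i * f i)" by auto
    have "\<forall>j<n. (\<Sum>i\<in>I. u i * A j i) = (\<Sum>i\<in>I. w i * A j i)"
      using d(2) by (simp add: sum_u)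
    moreover have "(\<Sum>i\<in>I. w i * f i) \<le> (\<Sum>i\<in>I. u i * f i)"
      using d(3) t0 by (simp add: sum_u)
    ultimately show ?thesis using w' by (intro exI[of _ w']) auto
  qed
qed

section \<open>Simultaneous convergence of finitely many bounded coordinates\<close>

text \<open>Bolzano-Weierstrass coordinate by coordinate: each new coordinate only thins the
  subsequence further, which preserves the limits found before. It is applied once to atoms and once
  to weights.\<close>

lemma common_convergent_subsequence:
  fixes f :: "nat \<Rightarrow> nat \<Rightarrow> real"
  assumes "\<And>n i. f n i \<in> {l..u}"
  shows "\<exists>r g. strict_mono r \<and> (\<forall>i<K. g i \<in> {l..u} \<and> (\<lambda>n. f (r n) i) \<longlonglongrightarrow> g i)"
proof (induction K)
  case 0
  show ?case by (auto intro!: exI[of _ id] simp: strict_mono_def)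
next
  case (Suc K)
  then obtain r g where r: "strict_mono (r :: nat \<Rightarrow> nat)"
    "\<forall>i<K. g i \<in> {l..u} \<and> (\<lambda>n. f (r n) i) \<longlonglongrightarrow> g i" by auto
  have "seq_compact {l..u}" by (intro compact_imp_seq_compact) simp
  then obtain y s where s: "y \<in> {l..u}" "strict_mono (s :: nat \<Rightarrow> nat)"
    "((\<lambda>n. f (r n) K) \<circ> s) \<longlonglongrightarrow> y"
    using assms by (elim seq_compactE[where f = "\<lambda>n. f (r n) K"]) auto
  have "(g(K := y)) i \<in> {l..u} \<and> (\<lambda>n. f ((r \<circ> s) n) i) \<longlonglongrightarrow> (g(K := y)) i"
    if "i < Suc K" for i
  proof (cases "i = K")
    case True
    then show ?thesis using s by (simp add: o_def)
  next
    case False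
    then have "i < K" using that by simp
    then have "((\<lambda>n. f (r n) i) \<circ> s) \<longlonglongrightarrow> g i" "g i \<in> {l..u}"
      using r s by (auto intro: LIMSEQ_subseq_LIMSEQ)
    then show ?thesis using False by (simp add: o_def)
  qed
  then show ?case using strict_mono_o[OF r(1) s(2)] by blast
qed

section \<open>Continuous integrands, quadrature and discrete measures on
  \<open>{a..b}\<close>\<close>

lemma prob_onD:
  assumes "\<mu> \<in> prob_on a b"
  shows "prob_space \<mu>" "sets \<mu> = sets (restrict_space borel {a..b})" "space \<mu> = {a..b}"
  using assms sets_eq_imp_space_eq[of \<mu> "restrict_space borel {a..b}"]
  by (auto simp: prob_on_def space_restrict_space)

text \<open>The measure lives on the trace of the Borel sets on \<open>{a..b}\<close>, so continuity
  there already gives measurability, and compactness gives the bound that makes \<open>h\<close>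
  integrable.\<close>

lemma prob_on_continuous:
  fixes h :: "real \<Rightarrow> real"
  assumes \<mu>: "\<mu> \<in> prob_on a b" and h: "continuous_on {a..b} h"
  shows "integrable \<mu> h"
    and "\<And>B. (\<And>x. x \<in> {a..b} \<Longrightarrow> \<bar>h x\<bar> \<le> B) \<Longrightarrow> \<bar>\<integral>x. h x \<partial>\<mu>\<bar> \<le> B"
    and "h \<in> borel_measurable \<mu>"
proof -
  interpret prob_space \<mu> using prob_onD[OF \<mu>] by simp
  have "h \<in> borel_measurable (restrict_space borel {a..b})"
    by (intro borel_measurable_continuous_on_restrict h)
  then show meas: "h \<in> borel_measurable \<mu>"
    using measurable_cong_sets[OF prob_onD(2)[OF \<mu>] refl, where 'b = real] by blast
  have "compact (h ` {a..b})" by (intro compact_continuous_image h) simp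
  then obtain B where B: "\<And>x. x \<in> {a..b} \<Longrightarrow> \<bar>h x\<bar> \<le> B"
    using compact_imp_bounded by (fastforce simp: bounded_iff)
  show int: "integrable \<mu> h"
    using B prob_onD(3)[OF \<mu>] meas by (intro integrable_const_bound[where B = B]) auto
  show "\<bar>\<integral>x. h x \<partial>\<mu>\<bar> \<le> C" if "\<And>x. x \<in> {a..b} \<Longrightarrow> \<bar>h x\<bar> \<le> C" for C
  proof -
    have "\<bar>\<integral>x. h x \<partial>\<mu>\<bar> \<le> (\<integral>x. \<bar>h x\<bar> \<partial>\<mu>)" by (rule integral_abs_bound)
    also have "\<dots> \<le> C"
      using int that prob_onD(3)[OF \<mu>] by (intro integral_le_const) auto
    finally show ?thesis .
  qed
qed

text \<open>Each \<open>t\<close> is rounded down to a grid of mesh \<open>1 / Suc n\<close>, and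
  the mass of each cell is put on its grid point. The integrals converge by dominated convergence.
  The total mass stays exactly \<open>1\<close>; only the other integrals carry an error.\<close>

lemma finite_quadrature_approximation:
  fixes \<phi> :: "'j \<Rightarrow> real \<Rightarrow> real"
  assumes \<mu>: "\<mu> \<in> prob_on a b" and J: "finite J"
    and \<phi>: "\<And>j. j \<in> J \<Longrightarrow> continuous_on {a..b} (\<phi> j)" and "e > 0"
  shows "\<exists>(I :: int set) x w. finite I \<and> (\<forall>i. x i \<in> {a..b}) \<and> (\<forall>i\<in>I. w i \<ge> 0) \<and>
    (\<Sum>i\<in>I. w i) = 1 \<and> (\<forall>j\<in>J. \<bar>(\<Sum>i\<in>I. w i * \<phi> j (x i)) - (\<integral>t. \<phi> j t \<partial>\<mu>)\<bar> < e)"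
proof -
  interpret prob_space \<mu> using prob_onD[OF \<mu>] by simp
  have sp: "space \<mu> = {a..b}" using prob_onD[OF \<mu>] by simp
  then have ab: "a \<le> b" using not_empty by auto
  have id_meas [measurable]: "(\<lambda>t. t) \<in> borel_measurable \<mu>"
    by (rule prob_on_continuous(3)[OF \<mu>]) simp
  \<comment> \<open>Rounding down may fall below \<open>a\<close>, so grid points are clipped to
    \<open>{a..b}\<close>, the only place where the \<open>\<phi> j\<close> are known to be
    continuous.\<close>
  define y where "y = (\<lambda>n i. min b (max a (real_of_int i / real (Suc n))))"
  define \<iota> where "\<iota> = (\<lambda>n t. \<lfloor>t * real (Suc n)\<rfloor>)"
  define I where "I = (\<lambda>n. {\<iota> n a..\<iota> n b})"
  define w where "w = (\<lambda>n i. prob {t\<in>space \<mu>. \<iota> n t = i})"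
  have y: "y n i \<in> {a..b}" for n i using ab by (auto simp: y_def)
  have \<iota>_meas [measurable]: "\<iota> n \<in> measurable \<mu> (count_space UNIV)" for n
    unfolding \<iota>_def by measurable
  have sets_w [measurable]: "{t\<in>space \<mu>. \<iota> n t = i} \<in> sets \<mu>" for n i
    by measurable
  have \<iota>_I: "\<iota> n t \<in> I n" if "t \<in> {a..b}" for n t
    using that by (auto simp: I_def \<iota>_def intro!: floor_mono mult_right_mono)
  \<comment> \<open>The cells partition \<open>{a..b}\<close>, so the quadrature sum is exactly the
    integral of \<open>g\<close> at the rounded point. This turns convergence of sums into
    convergence of integrals over the fixed measure \<open>\<mu>\<close>.\<close>
  have sum_eq: "(\<Sum>i\<in>I n. w n i * g (y n i)) = (\<integral>t. g (y n (\<iota> n t)) \<partial>\<mu>)" for n and g :: "real \<Rightarrow> real"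
  proof -
    have "(\<integral>t. g (y n (\<iota> n t)) \<partial>\<mu>) =
        (\<integral>t. (\<Sum>i\<in>I n. g (y n i) * indicator {t\<in>space \<mu>. \<iota> n t = i} t) \<partial>\<mu>)"
    proof (rule Bochner_Integration.integral_cong[OF refl])
      fix t assume t: "t \<in> space \<mu>"
      have "(\<Sum>i\<in>I n. g (y n i) * indicator {t\<in>space \<mu>. \<iota> n t = i} t) =
          (\<Sum>i\<in>I n. if i = \<iota> n t then g (y n i) else 0)"
        using t by (intro sum.cong) (auto simp: indicator_def)
      also have "\<dots> = g (y n (\<iota> n t))"
        using \<iota>_I[of t n] t sp by (simp add: I_def)
      finally show "g (y n (\<iota> n t)) =
          (\<Sum>i\<in>I n. g (y n i) * indicator {t\<in>space \<mu>. \<iota> n t = i} t)" by simp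
    qed
    also have "\<dots> = (\<Sum>i\<in>I n. \<integral>t. g (y n i) * indicator {t\<in>space \<mu>. \<iota> n t = i} t \<partial>\<mu>)"
      by (intro Bochner_Integration.integral_sum integrable_mult_right
          integrable_real_indicator) (auto simp: emeasure_eq_measure)
    also have "\<dots> = (\<Sum>i\<in>I n. w n i * g (y n i))"
      by (intro sum.cong refl) (simp add: w_def mult.commute)
    finally show ?thesis by simp
  qed
  have y_lim: "(\<lambda>n. y n (\<iota> n t)) \<longlonglongrightarrow> t" if t: "t \<in> {a..b}" for t
  proof -
    have "(\<lambda>n. real_of_int (\<iota> n t) / real (Suc n)) \<longlonglongrightarrow> t"
    proof (rule tendsto_sandwich)
      show "(\<lambda>n. t - inverse (real (Suc n))) \<longlonglongrightarrow> t"
        using tendsto_diff[OF tendsto_const LIMSEQ_inverse_real_of_nat, of t] by simp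
      show "\<forall>\<^sub>F n in sequentially. t - inverse (real (Suc n)) \<le> real_of_int (\<iota> n t) / real (Suc n)"
      proof (intro always_eventually allI)
        fix n
        have "t * real (Suc n) - 1 \<le> real_of_int (\<iota> n t)" unfolding \<iota>_def by linarith
        then show "t - inverse (real (Suc n)) \<le> real_of_int (\<iota> n t) / real (Suc n)"
          by (simp add: pos_le_divide_eq left_diff_distrib del: of_nat_Suc)
      qed
      show "\<forall>\<^sub>F n in sequentially. real_of_int (\<iota> n t) / real (Suc n) \<le> t"
        by (intro always_eventually allI)
          (simp add: \<iota>_def pos_divide_le_eq del: of_nat_Suc)
    qed simp
    then have "(\<lambda>n. y n (\<iota> n t)) \<longlonglongrightarrow> min b (max a t)"
      unfolding y_def by (intro tendsto_min tendsto_max tendsto_const)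
    moreover have "min b (max a t) = t" using t by auto
    ultimately show ?thesis by simp
  qed
  have lim: "(\<lambda>n. \<Sum>i\<in>I n. w n i * \<phi> j (y n i)) \<longlonglongrightarrow> (\<integral>t. \<phi> j t \<partial>\<mu>)" if j: "j \<in> J" for j
  proof -
    have "compact (\<phi> j ` {a..b})" by (intro compact_continuous_image \<phi> j) simp
    then obtain B where B: "\<And>x. x \<in> {a..b} \<Longrightarrow> \<bar>\<phi> j x\<bar> \<le> B"
      using compact_imp_bounded by (fastforce simp: bounded_iff)
    have "(\<lambda>n. \<integral>t. \<phi> j (y n (\<iota> n t)) \<partial>\<mu>) \<longlonglongrightarrow> (\<integral>t. \<phi> j t \<partial>\<mu>)"
    proof (rule integral_dominated_convergence[where w = "\<lambda>_. B"])
      show "\<phi> j \<in> borel_measurable \<mu>" by (rule prob_on_continuous(3)[OF \<mu> \<phi>[OF j]])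
      \<comment> \<open>The integrand factors through the integer \<open>\<iota> n t\<close>, and
        every function on a discrete space is measurable.\<close>
      show "(\<lambda>t. \<phi> j (y n (\<iota> n t))) \<in> borel_measurable \<mu>" for n
        by (rule measurable_compose[OF \<iota>_meas]) simp
      show "AE t in \<mu>. (\<lambda>n. \<phi> j (y n (\<iota> n t))) \<longlonglongrightarrow> \<phi> j t"
      proof (rule AE_I2)
        fix t assume "t \<in> space \<mu>"
        then have "t \<in> {a..b}" using sp by simp
        then show "(\<lambda>n. \<phi> j (y n (\<iota> n t))) \<longlonglongrightarrow> \<phi> j t"
          using y by (intro continuous_on_tendsto_compose[OF \<phi>[OF j] y_lim]) auto
      qed
      show "AE t in \<mu>. norm (\<phi> j (y n (\<iota> n t))) \<le> B" for n
        using B[OF y] by simp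
    qed simp
    then show ?thesis by (simp add: sum_eq)
  qed
  \<comment> \<open>Finiteness of \<open>J\<close> allows one grid to serve all integrands at
    once.\<close>
  have "\<forall>\<^sub>F n in sequentially. \<forall>j\<in>J. \<bar>(\<Sum>i\<in>I n. w n i * \<phi> j (y n i)) - (\<integral>t. \<phi> j t \<partial>\<mu>)\<bar> < e"
    using J tendstoD[OF lim \<open>e > 0\<close>]
    by (intro eventually_ball_finite) (auto simp: dist_real_def)
  then obtain n where "\<forall>j\<in>J. \<bar>(\<Sum>i\<in>I n. w n i * \<phi> j (y n i)) - (\<integral>t. \<phi> j t \<partial>\<mu>)\<bar> < e"
    using eventually_happens' sequentially_bot by blast
  moreover have "(\<Sum>i\<in>I n. w n i) = 1"
    using sum_eq[of n "\<lambda>_. 1"] by (simp add: prob_space)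
  moreover have "w n i \<ge> 0" for i by (simp add: w_def)
  moreover have "finite (I n)" by (simp add: I_def)
  ultimately show ?thesis using y by (intro exI[of _ "I n"] exI[of _ "y n"] exI[of _ "w n"]) auto
qed

text \<open>The measure is the image under \<open>x\<close> of a probability mass function on the
  indices. Points \<open>x i\<close> may coincide and weights may vanish, so \<open>K\<close> is
  only an upper bound for the number of atoms.\<close>

lemma discrete_measure:
  fixes x w :: "nat \<Rightarrow> real"
  assumes x: "\<And>i. x i \<in> {a..b}" and w: "\<And>i. i < K \<Longrightarrow> w i \<ge> 0" and w1: "(\<Sum>i<K. w i) = 1"
  shows "\<exists>\<nu>\<in>prob_on a b. supported_on_at_most K \<nu> \<and>
    (\<forall>h. continuous_on {a..b} h \<longrightarrow> (\<integral>t. h t \<partial>\<nu>) = (\<Sum>i<K. w i * h (x i)))"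
proof -
  \<comment> \<open>A mass function on \<open>nat\<close> needs values at all indices, whereas
    \<open>w\<close> is controlled only below \<open>K\<close>.\<close>
  define v where "v = (\<lambda>i. if i < K then w i else 0)"
  have v: "(\<integral>\<^sup>+ i. ennreal (v i) \<partial>count_space UNIV) = 1"
  proof -
    have "(\<integral>\<^sup>+ i. ennreal (v i) \<partial>count_space UNIV) = (\<Sum>i<K. ennreal (v i))"
      by (intro nn_integral_count_space') (auto simp: v_def)
    also have "\<dots> = ennreal (\<Sum>i<K. w i)"
      using w by (subst sum_ennreal[symmetric]) (auto simp: v_def)
    finally show ?thesis by (simp add: w1)
  qed
  have v0: "v i \<ge> 0" for i using w by (simp add: v_def)
  define P where "P = embed_pmf v"
  have P: "pmf P i = v i" for i unfolding P_def by (intro pmf_embed_pmf v v0)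
  have set_P: "set_pmf P \<subseteq> {..<K}" by (auto simp: set_pmf_eq P v_def)
  define \<nu> where "\<nu> = distr (measure_pmf P) (restrict_space borel {a..b}) x"
  have meas [measurable]: "x \<in> measurable (measure_pmf P) (restrict_space borel {a..b})"
    using x by (simp add: measurable_def space_restrict_space)
  have \<nu>: "\<nu> \<in> prob_on a b"
    using measure_pmf.prob_space_distr[OF meas] by (simp add: prob_on_def \<nu>_def)
  have "x ` {..<K} \<in> sets (restrict_space borel {a..b})"
    using x by (auto simp: sets_restrict_space_iff intro!: finite_imp_closed borel_closed)
  then have "measure \<nu> (x ` {..<K}) = measure P (x -` x ` {..<K})"
    unfolding \<nu>_def by (subst measure_distr[OF meas]) (simp_all only: space_measure_pmf Int_UNIV_right)
  also have "\<dots> = 1"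
    using set_P by (intro measure_pmf.prob_eq_1[THEN iffD2]) (auto simp: AE_measure_pmf_iff)
  finally have "supported_on_at_most K \<nu>"
    unfolding supported_on_at_most_def prob_onD(3)[OF \<nu>]
    using x card_image_le[of "{..<K}" x] by (intro exI[of _ "x ` {..<K}"]) auto
  moreover have "(\<integral>t. h t \<partial>\<nu>) = (\<Sum>i<K. w i * h (x i))" if h: "continuous_on {a..b} h"
    for h :: "real \<Rightarrow> real"
  proof -
    have "(\<integral>t. h t \<partial>\<nu>) = (\<integral>i. h (x i) \<partial>measure_pmf P)"
      unfolding \<nu>_def by (intro integral_distr meas borel_measurable_continuous_on_restrict h)
    also have "\<dots> = (\<Sum>i<K. pmf P i *\<^sub>R h (x i))"
      using set_P by (intro integral_measure_pmf) auto
    finally show ?thesis by (simp add: P v_def)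
  qed
  ultimately show ?thesis using \<nu> by blast
qed

section \<open>Maximizing sequences with at most \<open>m + 1\<close> atoms and their limits\<close>

text \<open>Quadrature first, then \<open>reduce_support\<close>, which keeps the mass and the
  constraint sums of the quadrature exactly. The reduction may raise the objective, hence the
  one-sided estimate for \<open>h\<close>.\<close>

lemma few_atoms_approximation:
  fixes \<phi> :: "nat \<Rightarrow> real \<Rightarrow> real" and h :: "real \<Rightarrow> real"
  assumes \<mu>: "\<mu> \<in> prob_on a b" and \<phi>: "\<And>j. j \<in> {1..m} \<Longrightarrow> continuous_on {a..b} (\<phi> j)"
    and h: "continuous_on {a..b} h" and e: "e > 0"
  shows "\<exists>x w. (\<forall>i. x i \<in> {a..b}) \<and> (\<forall>i. w i \<in> {0..1}) \<and> (\<Sum>i<Suc m. w i) = 1 \<and>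
    (\<forall>j\<in>{1..m}. \<bar>(\<Sum>i<Suc m. w i * \<phi> j (x i)) - (\<integral>t. \<phi> j t \<partial>\<mu>)\<bar> < e) \<and>
    (\<Sum>i<Suc m. w i * h (x i)) > (\<integral>t. h t \<partial>\<mu>) - e"
proof -
  \<comment> \<open>Constraints are indexed from \<open>1\<close>, so the free index
    \<open>0\<close> carries the objective and a single quadrature approximates everything.\<close>
  have "\<exists>(I :: int set) x w. finite I \<and> (\<forall>i. x i \<in> {a..b}) \<and> (\<forall>i\<in>I. w i \<ge> 0) \<and>
    (\<Sum>i\<in>I. w i) = 1 \<and> (\<forall>j\<in>{0..m}. \<bar>(\<Sum>i\<in>I. w i * (\<phi>(0 := h)) j (x i)) - (\<integral>t. (\<phi>(0 := h)) j t \<partial>\<mu>)\<bar> < e)"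
    using \<phi> h e by (intro finite_quadrature_approximation \<mu>) auto
  then obtain I :: "int set" and x w where I: "finite I" and x: "\<And>i. x i \<in> {a..b}"
    and w: "\<forall>i\<in>I. w i \<ge> 0" "(\<Sum>i\<in>I. w i) = 1"
    and approx: "\<And>j. j \<in> {0..m} \<Longrightarrow> \<bar>(\<Sum>i\<in>I. w i * (\<phi>(0 := h)) j (x i)) - (\<integral>t. (\<phi>(0 := h)) j t \<partial>\<mu>)\<bar> < e"
    by blast
  \<comment> \<open>Row \<open>0\<close> is now the total mass instead of the objective. Together
    with the \<open>m\<close> constraints this makes \<open>Suc m\<close> rows, the source of the
    bound \<open>m + 1\<close>.\<close>
  define A where "A = (\<lambda>j i. if j = 0 then 1 else \<phi> j (x i))"
  obtain u where u: "\<forall>i\<in>I. u i \<ge> 0" "card {i\<in>I. u i \<noteq> 0} \<le> Suc m"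
    "\<forall>j<Suc m. (\<Sum>i\<in>I. u i * A j i) = (\<Sum>i\<in>I. w i * A j i)"
    "(\<Sum>i\<in>I. w i * h (x i)) \<le> (\<Sum>i\<in>I. u i * h (x i))"
    using reduce_support[of I w 0 "Suc m" A "\<lambda>i. h (x i)"] I w by (auto simp: A_def)
  define T where "T = {i\<in>I. u i \<noteq> 0}"
  have T: "finite T" "card T \<le> Suc m" using I u by (auto simp: T_def)
  obtain f where f: "bij_betw f {..<card T} T"
    using ex_bij_betw_nat_finite[OF T(1)] by (auto simp: atLeast0LessThan)
  \<comment> \<open>The surviving atoms are renumbered and padded with zero weights to exactly
    \<open>Suc m\<close> entries, so that a sequence of such approximations has a fixed number of
    coordinates. The padding values of \<open>f\<close> are harmless, since every \<open>x i\<close>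
    lies in \<open>{a..b}\<close>.\<close>
  define v where "v = (\<lambda>k. if k < card T then u (f k) else 0)"
  have sum_v: "(\<Sum>k<Suc m. v k * g (f k)) = (\<Sum>i\<in>I. u i * g i)" for g
  proof -
    have "(\<Sum>k<Suc m. v k * g (f k)) = (\<Sum>k<card T. v k * g (f k))"
      using T by (intro sum.mono_neutral_right) (auto simp: v_def)
    also have "\<dots> = (\<Sum>k<card T. u (f k) * g (f k))"
      by (intro sum.cong) (auto simp: v_def)
    also have "\<dots> = (\<Sum>i\<in>T. u i * g i)"
      by (rule sum.reindex_bij_betw[OF f])
    also have "\<dots> = (\<Sum>i\<in>I. u i * g i)"
      using I by (intro sum.mono_neutral_left) (auto simp: T_def)
    finally show ?thesis .
  qed
  have v0: "v k \<ge> 0" for k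
    using u(1) bij_betwE[OF f] by (auto simp: v_def T_def)
  have v1: "(\<Sum>k<Suc m. v k) = 1"
    using sum_v[of "\<lambda>_. 1"] u(3)[rule_format, of 0] w by (simp add: A_def)
  have "v k \<le> 1" for k
  proof (cases "k < Suc m")
    case True
    then show ?thesis using member_le_sum[of k "{..<Suc m}" v] v0 v1 by simp
  next
    case False
    then show ?thesis using T by (simp add: v_def)
  qed
  moreover have "\<bar>(\<Sum>k<Suc m. v k * \<phi> j (x (f k))) - (\<integral>t. \<phi> j t \<partial>\<mu>)\<bar> < e" if "j \<in> {1..m}" for j
    using sum_v[of "\<lambda>i. \<phi> j (x i)"] u(3)[rule_format, of j] approx[of j] that
    by (simp add: A_def)
  moreover have "(\<Sum>k<Suc m. v k * h (x (f k))) > (\<integral>t. h t \<partial>\<mu>) - e"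
    using sum_v[of "\<lambda>i. h (x i)"] u(4) approx[of 0] by (simp add: abs_less_iff)
  ultimately show ?thesis using x v0 v1
    by (intro exI[of _ "\<lambda>k. x (f k)"] exI[of _ v]) (auto simp del: sum.lessThan_Suc)
qed

text \<open>Approximations with \<open>Suc m\<close> atoms and errors tending to \<open>0\<close>
  vary in a compact set of atoms and weights. In the limit the constraints become exact and the loss
  in the objective disappears.\<close>

lemma discrete_maximizer:
  fixes \<phi> :: "nat \<Rightarrow> real \<Rightarrow> real" and h :: "real \<Rightarrow> real"
  assumes \<phi>: "\<And>j. j \<in> {1..m} \<Longrightarrow> continuous_on {a..b} (\<phi> j)"
    and h: "continuous_on {a..b} h"
    and approx: "\<And>e. e > 0 \<Longrightarrow>
      \<exists>\<mu>\<in>prob_on a b. (\<forall>j\<in>{1..m}. (\<integral>t. \<phi> j t \<partial>\<mu>) = c j) \<and> (\<integral>t. h t \<partial>\<mu>) > V - e"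
  shows "\<exists>\<nu>\<in>prob_on a b. supported_on_at_most (m + 1) \<nu> \<and>
    (\<forall>j\<in>{1..m}. (\<integral>t. \<phi> j t \<partial>\<nu>) = c j) \<and> (\<integral>t. h t \<partial>\<nu>) \<ge> V"
proof -
  define e where "e = (\<lambda>n. inverse (real (Suc n)))"
  have e0: "e n > 0" for n by (simp add: e_def)
  have e_lim: "e \<longlonglongrightarrow> 0" unfolding e_def by (rule LIMSEQ_inverse_real_of_nat)
  \<comment> \<open>One \<open>e n\<close> in the last clause pays for the choice of a nearly
    optimal measure, the other for its replacement by few atoms.\<close>
  define Q where "Q = (\<lambda>n x w. (\<forall>i. x i \<in> {a..b}) \<and> (\<forall>i. w i \<in> {0..1}) \<and>
    (\<Sum>i<Suc m. w i) = 1 \<and>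
    (\<forall>j\<in>{1..m}. \<bar>(\<Sum>i<Suc m. w i * \<phi> j (x i)) - c j\<bar> < e n) \<and>
    (\<Sum>i<Suc m. w i * h (x i)) > V - 2 * e n)"
  have "\<exists>x w. Q n x w" for n
  proof -
    obtain \<mu> where \<mu>: "\<mu> \<in> prob_on a b" "\<forall>j\<in>{1..m}. (\<integral>t. \<phi> j t \<partial>\<mu>) = c j"
      "(\<integral>t. h t \<partial>\<mu>) > V - e n"
      using approx[OF e0] by blast
    obtain x w where "\<forall>i. x i \<in> {a..b}" "\<forall>i. w i \<in> {0..1}" "(\<Sum>i<Suc m. w i) = 1"
      "\<forall>j\<in>{1..m}. \<bar>(\<Sum>i<Suc m. w i * \<phi> j (x i)) - (\<integral>t. \<phi> j t \<partial>\<mu>)\<bar> < e n"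
      "(\<Sum>i<Suc m. w i * h (x i)) > (\<integral>t. h t \<partial>\<mu>) - e n"
      using few_atoms_approximation[of \<mu> a b m \<phi> h, OF \<mu>(1) \<phi> h e0] by blast
    then have "Q n x w" unfolding Q_def using \<mu> by auto
    then show ?thesis by blast
  qed
  then obtain X W where "Q n (X n) (W n)" for n by metis
  then have X: "\<And>n i. X n i \<in> {a..b}" and W: "\<And>n i. W n i \<in> {0..1}"
    and W1: "\<And>n. (\<Sum>i<Suc m. W n i) = 1"
    and mom: "\<And>n j. j \<in> {1..m} \<Longrightarrow> \<bar>(\<Sum>i<Suc m. W n i * \<phi> j (X n i)) - c j\<bar> < e n"
    and val: "\<And>n. (\<Sum>i<Suc m. W n i * h (X n i)) > V - 2 * e n"
    unfolding Q_def by blast+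
  obtain r x where r: "strict_mono r"
    and x: "\<forall>i<Suc m. x i \<in> {a..b} \<and> (\<lambda>n. X (r n) i) \<longlonglongrightarrow> x i"
    using common_convergent_subsequence[of X a b "Suc m", OF X] by auto
  obtain s w where s: "strict_mono s"
    and w: "\<forall>i<Suc m. w i \<in> {0..1} \<and> (\<lambda>n. W (r (s n)) i) \<longlonglongrightarrow> w i"
    using common_convergent_subsequence[of "\<lambda>n. W (r n)" 0 1 "Suc m", OF W] by auto
  define q where "q = (\<lambda>n. r (s n))"
  have q: "strict_mono q" using r s by (simp add: q_def strict_mono_def)
  have e_q: "(\<lambda>n. e (q n)) \<longlonglongrightarrow> 0"
    using LIMSEQ_subseq_LIMSEQ[OF e_lim q] by (simp add: o_def)
  have W_lim: "(\<lambda>n. W (q n) i) \<longlonglongrightarrow> w i" if "i < Suc m" for i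
    using w that by (simp add: q_def)
  have X_lim: "(\<lambda>n. X (q n) i) \<longlonglongrightarrow> x i" if "i < Suc m" for i
  proof -
    have "((\<lambda>n. X (r n) i) \<circ> s) \<longlonglongrightarrow> x i" using x that s by (intro LIMSEQ_subseq_LIMSEQ) auto
    then show ?thesis by (simp add: q_def o_def)
  qed
  have lim: "(\<lambda>n. \<Sum>i<Suc m. W (q n) i * g (X (q n) i)) \<longlonglongrightarrow> (\<Sum>i<Suc m. w i * g (x i))"
    if g: "continuous_on {a..b} g" for g :: "real \<Rightarrow> real"
  proof (intro tendsto_sum tendsto_mult W_lim)
    fix i assume "i \<in> {..<Suc m}"
    then show "(\<lambda>n. g (X (q n) i)) \<longlonglongrightarrow> g (x i)"
      using x X by (intro continuous_on_tendsto_compose[OF g X_lim]) auto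
  qed auto
  \<comment> \<open>\<open>discrete_measure\<close> wants every point in \<open>{a..b}\<close>, but
    the limits \<open>x i\<close> are controlled only for \<open>i < Suc m\<close>.\<close>
  define z where "z = (\<lambda>i. if i < Suc m then x i else x 0)"
  have "(\<lambda>n. \<Sum>i<Suc m. W (q n) i) \<longlonglongrightarrow> (\<Sum>i<Suc m. w i)"
    by (intro tendsto_sum W_lim) auto
  then have w1: "(\<Sum>i<Suc m. w i) = 1"
    using W1 by (simp add: LIMSEQ_const_iff del: sum.lessThan_Suc)
  obtain \<nu> where \<nu>: "\<nu> \<in> prob_on a b" "supported_on_at_most (Suc m) \<nu>"
    and int: "\<And>g. continuous_on {a..b} g \<Longrightarrow> (\<integral>t. g t \<partial>\<nu>) = (\<Sum>i<Suc m. w i * g (z i))"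
  proof -
    have "z i \<in> {a..b}" for i using x by (cases "i < Suc m") (simp_all add: z_def)
    moreover have "w i \<ge> 0" if "i < Suc m" for i using w that by simp
    ultimately show ?thesis using that discrete_measure[OF _ _ w1] by blast
  qed
  have int': "(\<integral>t. g t \<partial>\<nu>) = (\<Sum>i<Suc m. w i * g (x i))" if "continuous_on {a..b} g" for g
    unfolding int[OF that] by (intro sum.cong) (auto simp: z_def)
  have "(\<integral>t. \<phi> j t \<partial>\<nu>) = c j" if j: "j \<in> {1..m}" for j
  proof -
    have "(\<lambda>n. (\<Sum>i<Suc m. W (q n) i * \<phi> j (X (q n) i)) - c j) \<longlonglongrightarrow> 0"
      using mom[OF j] less_imp_le by (intro Lim_null_comparison[OF _ e_q] always_eventually allI) auto
    then have "(\<lambda>n. \<Sum>i<Suc m. W (q n) i * \<phi> j (X (q n) i)) \<longlonglongrightarrow> c j"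
      by (rule LIM_zero_cancel)
    then show ?thesis
      unfolding int'[OF \<phi>[OF j]] by (intro LIMSEQ_unique[OF lim[OF \<phi>[OF j]]])
  qed
  moreover have "V \<le> (\<integral>t. h t \<partial>\<nu>)"
  proof -
    have "(\<lambda>n. V - 2 * e (q n)) \<longlonglongrightarrow> V - 2 * 0"
      by (intro tendsto_intros e_q)
    then have "V - 2 * 0 \<le> (\<Sum>i<Suc m. w i * h (x i))"
      using val by (intro LIMSEQ_le[OF _ lim[OF h]]) (auto intro!: exI[of _ 0] less_imp_le simp del: sum.lessThan_Suc)
    then show ?thesis by (simp add: int'[OF h] del: sum.lessThan_Suc)
  qed
  ultimately show ?thesis using \<nu> by auto
qed

section \<open>Attainment of supremum and infimum under general constraints\<close>

text \<open>A common generalization of both formulations: scaled powers of \<open>b - t\<close> for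
  the moment class, and plain powers of \<open>t\<close> for laws of random variables.\<close>

definition constrained :: "real \<Rightarrow> real \<Rightarrow> nat \<Rightarrow> (nat \<Rightarrow> real \<Rightarrow> real) \<Rightarrow> (nat \<Rightarrow> real) \<Rightarrow> real measure set" where
  "constrained a b m \<phi> c = {\<mu>\<in>prob_on a b. \<forall>j\<in>{1..m}. (\<integral>t. \<phi> j t \<partial>\<mu>) = c j}"

lemma bdd_integrals:
  fixes h :: "real \<Rightarrow> real"
  assumes "continuous_on {a..b} h"
  shows "bdd_above ((\<lambda>\<mu>. \<integral>t. h t \<partial>\<mu>) ` constrained a b m \<phi> c)"
    and "bdd_below ((\<lambda>\<mu>. \<integral>t. h t \<partial>\<mu>) ` constrained a b m \<phi> c)"
proof -
  have "compact (h ` {a..b})" by (intro compact_continuous_image assms) simp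
  then obtain B where B: "\<And>x. x \<in> {a..b} \<Longrightarrow> \<bar>h x\<bar> \<le> B"
    using compact_imp_bounded by (fastforce simp: bounded_iff)
  have bound: "\<bar>\<integral>t. h t \<partial>\<mu>\<bar> \<le> B" if "\<mu> \<in> constrained a b m \<phi> c" for \<mu>
    using that prob_on_continuous(2)[OF _ assms B] by (auto simp: constrained_def)
  show "bdd_above ((\<lambda>\<mu>. \<integral>t. h t \<partial>\<mu>) ` constrained a b m \<phi> c)"
    using bound by (intro bdd_aboveI2[of _ _ B]) (simp add: abs_le_iff)
  show "bdd_below ((\<lambda>\<mu>. \<integral>t. h t \<partial>\<mu>) ` constrained a b m \<phi> c)"
    using bound by (intro bdd_belowI2[of _ "- B"]) (smt (verit))
qed

text \<open>Near-optimal measures exist below the supremum \<open>V\<close>, so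
  \<open>discrete_maximizer\<close> yields a feasible discrete measure with value at least
  \<open>V\<close>; being feasible, it cannot exceed \<open>V\<close>.\<close>

lemma sup_attained:
  fixes \<phi> :: "nat \<Rightarrow> real \<Rightarrow> real" and h :: "real \<Rightarrow> real"
  assumes \<phi>: "\<And>j. j \<in> {1..m} \<Longrightarrow> continuous_on {a..b} (\<phi> j)"
    and h: "continuous_on {a..b} h" and ne: "constrained a b m \<phi> c \<noteq> {}"
  shows "\<exists>\<nu>\<in>constrained a b m \<phi> c. supported_on_at_most (m + 1) \<nu> \<and>
    (\<integral>t. h t \<partial>\<nu>) = (SUP \<mu>\<in>constrained a b m \<phi> c. \<integral>t. h t \<partial>\<mu>)"
proof -
  define V where "V = (SUP \<mu>\<in>constrained a b m \<phi> c. \<integral>t. h t \<partial>\<mu>)"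
  have "\<exists>\<mu>\<in>prob_on a b. (\<forall>j\<in>{1..m}. (\<integral>t. \<phi> j t \<partial>\<mu>) = c j) \<and> (\<integral>t. h t \<partial>\<mu>) > V - e"
    if "e > 0" for e
  proof -
    have "V - e < (SUP \<mu>\<in>constrained a b m \<phi> c. \<integral>t. h t \<partial>\<mu>)" using that by (simp add: V_def)
    then obtain \<mu> where "\<mu> \<in> constrained a b m \<phi> c" "V - e < (\<integral>t. h t \<partial>\<mu>)"
      using less_cSUP_iff[OF ne bdd_integrals(1)[OF h]] by blast
    then show ?thesis by (auto simp: constrained_def)
  qed
  then obtain \<nu> where \<nu>: "\<nu> \<in> constrained a b m \<phi> c" "supported_on_at_most (m + 1) \<nu>"
    "(\<integral>t. h t \<partial>\<nu>) \<ge> V"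
    using discrete_maximizer[of m a b \<phi> h c V, OF \<phi> h] by (force simp: constrained_def)
  moreover have "(\<integral>t. h t \<partial>\<nu>) \<le> V"
    unfolding V_def by (intro cSUP_upper \<nu> bdd_integrals h)
  ultimately show ?thesis unfolding V_def by (intro bexI[of _ \<nu>]) auto
qed

text \<open>The supremum case for \<open>- h\<close>, since a real infimum is the negated supremum
  of the negated values.\<close>

lemma inf_attained:
  fixes \<phi> :: "nat \<Rightarrow> real \<Rightarrow> real" and h :: "real \<Rightarrow> real"
  assumes \<phi>: "\<And>j. j \<in> {1..m} \<Longrightarrow> continuous_on {a..b} (\<phi> j)"
    and h: "continuous_on {a..b} h" and ne: "constrained a b m \<phi> c \<noteq> {}"
  shows "\<exists>\<nu>\<in>constrained a b m \<phi> c. supported_on_at_most (m + 1) \<nu> \<and>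
    (\<integral>t. h t \<partial>\<nu>) = (INF \<mu>\<in>constrained a b m \<phi> c. \<integral>t. h t \<partial>\<mu>)"
proof -
  have "continuous_on {a..b} (\<lambda>t. - h t)" by (intro continuous_intros h)
  from sup_attained[of m a b \<phi>, OF \<phi> this ne] obtain \<nu> where
    "\<nu> \<in> constrained a b m \<phi> c" "supported_on_at_most (m + 1) \<nu>"
    "- (\<integral>t. h t \<partial>\<nu>) = (SUP \<mu>\<in>constrained a b m \<phi> c. - (\<integral>t. h t \<partial>\<mu>))"
    by auto
  then show ?thesis
    by (intro bexI[of _ \<nu>]) (simp_all add: Inf_real_def image_image)
qed

section \<open>Translation to moment classes and to random variables\<close>

lemma moment_class_eq:
  "moment_class a b m c = constrained a b m (\<lambda>j t. 1 / fact j * (b - t) ^ j) c"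
  by (simp add: moment_class_def constrained_def)

text \<open>Change of variables for the law of \<open>X\<close>. The sample type is arbitrary, so
  every random variable is compared with measures on \<open>{a..b}\<close> this way.\<close>

lemma moment_rvs_distr:
  fixes p :: "real poly"
  assumes "(\<Omega>, X) \<in> moment_rvs a b m q"
  shows "distr \<Omega> (restrict_space borel {a..b}) X \<in> constrained a b m (\<lambda>j t. t ^ j) q"
    and "(\<integral>t. poly p t \<partial>distr \<Omega> (restrict_space borel {a..b}) X) = (\<integral>\<omega>. poly p (X \<omega>) \<partial>\<Omega>)"
proof -
  interpret prob_space \<Omega> using assms by (simp add: moment_rvs_def)
  have X: "X \<in> \<Omega> \<rightarrow>\<^sub>M restrict_space borel {a..b}" and q: "\<forall>j\<in>{1..m}. (\<integral>\<omega>. X \<omega> ^ j \<partial>\<Omega>) = q j"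
    using assms by (auto simp: moment_rvs_def)
  have int: "(\<integral>t. h t \<partial>distr \<Omega> (restrict_space borel {a..b}) X) = (\<integral>\<omega>. h (X \<omega>) \<partial>\<Omega>)"
    if "continuous_on {a..b} h" for h :: "real \<Rightarrow> real"
    by (intro integral_distr X borel_measurable_continuous_on_restrict that)
  show "distr \<Omega> (restrict_space borel {a..b}) X \<in> constrained a b m (\<lambda>j t. t ^ j) q"
    using q by (auto simp: constrained_def prob_on_def int continuous_intros intro!: prob_space_distr X)
  show "(\<integral>t. poly p t \<partial>distr \<Omega> (restrict_space borel {a..b}) X) = (\<integral>\<omega>. poly p (X \<omega>) \<partial>\<Omega>)"
    by (intro int continuous_intros)
qed

text \<open>Converse passage from measures to random variables: the identity map on
  \<open>\<mu>\<close> has law \<open>\<mu>\<close>.\<close>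

lemma identity_moment_rv:
  assumes "\<mu> \<in> constrained a b m (\<lambda>j t. t ^ j) q"
  shows "(\<mu>, \<lambda>t. t) \<in> moment_rvs a b m q"
    and "supported_on_at_most n \<mu> \<Longrightarrow> discrete_rv_at_most a b n \<mu> (\<lambda>t. t)"
proof -
  have \<mu>: "\<mu> \<in> prob_on a b" and "\<forall>j\<in>{1..m}. (\<integral>t. t ^ j \<partial>\<mu>) = q j"
    using assms by (auto simp: constrained_def)
  moreover have "(\<lambda>t. t) \<in> \<mu> \<rightarrow>\<^sub>M restrict_space borel {a..b}"
    by (intro measurable_ident_sets prob_onD(2)[OF \<mu>])
  ultimately show "(\<mu>, \<lambda>t. t) \<in> moment_rvs a b m q"
    using prob_onD(1)[OF \<mu>] by (simp add: moment_rvs_def)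
  show "supported_on_at_most n \<mu> \<Longrightarrow> discrete_rv_at_most a b n \<mu> (\<lambda>t. t)"
    by (simp add: discrete_rv_at_most_def distr_id2[OF prob_onD(2)[OF \<mu>, symmetric]])
qed

text \<open>Laws in one direction and identity maps in the other show that both problems range over
  the same values, hence have the same supremum and infimum.\<close>

lemma moment_rvs_image:
  "(\<lambda>(\<Omega>, X). \<integral>\<omega>. poly p (X \<omega>) \<partial>\<Omega>) `
      (moment_rvs a b m q :: (real measure \<times> (real \<Rightarrow> real)) set) =
    (\<lambda>\<mu>. \<integral>t. poly p t \<partial>\<mu>) ` constrained a b m (\<lambda>j t. t ^ j) q"
proof (intro equalityI subsetI)
  fix v assume "v \<in> (\<lambda>(\<Omega>, X). \<integral>\<omega>. poly p (X \<omega>) \<partial>\<Omega>) `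
      (moment_rvs a b m q :: (real measure \<times> (real \<Rightarrow> real)) set)"
  then obtain \<Omega> :: "real measure" and X where "(\<Omega>, X) \<in> moment_rvs a b m q"
    "v = (\<integral>\<omega>. poly p (X \<omega>) \<partial>\<Omega>)" by auto
  then show "v \<in> (\<lambda>\<mu>. \<integral>t. poly p t \<partial>\<mu>) ` constrained a b m (\<lambda>j t. t ^ j) q"
    by (intro image_eqI[OF _ moment_rvs_distr(1)]) (simp_all add: moment_rvs_distr(2))
next
  fix v assume "v \<in> (\<lambda>\<mu>. \<integral>t. poly p t \<partial>\<mu>) ` constrained a b m (\<lambda>j t. t ^ j) q"
  then obtain \<mu> where "\<mu> \<in> constrained a b m (\<lambda>j t. t ^ j) q" "v = (\<integral>t. poly p t \<partial>\<mu>)" by auto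
  then show "v \<in> (\<lambda>(\<Omega>, X). \<integral>\<omega>. poly p (X \<omega>) \<partial>\<Omega>) `
      (moment_rvs a b m q :: (real measure \<times> (real \<Rightarrow> real)) set)"
    by (intro image_eqI[OF _ identity_moment_rv(1)]) simp_all
qed

theorem corollary6:
  fixes a b :: real and m :: nat
  assumes "a < b" and "m \<ge> 1"
  shows
    "(\<forall>c :: nat \<Rightarrow> real.
        (\<exists>\<epsilon>. admissible a b \<epsilon> \<and> (\<forall>j\<in>{1..m}. c j = \<epsilon> j)) \<longrightarrow>
        (\<forall>k.
          (\<exists>\<mu>\<in>moment_class a b m c. supported_on_at_most (m + 1) \<mu> \<and>
             (\<integral>t. (b - t) ^ k / fact k \<partial>\<mu>) = M_plus a b m k c) \<and>
          (\<exists>\<mu>\<in>moment_class a b m c. supported_on_at_most (m + 1) \<mu> \<and>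
             (\<integral>t. (b - t) ^ k / fact k \<partial>\<mu>) = M_minus a b m k c)))
     \<and>
     (\<forall>(q :: nat \<Rightarrow> real) (\<Omega> :: 'w measure) X (p :: real poly).
        (\<Omega>, X) \<in> moment_rvs a b m q \<longrightarrow>
          lower_expectation a b m q p \<le> (\<integral>\<omega>. poly p (X \<omega>) \<partial>\<Omega>) \<and>
          (\<integral>\<omega>. poly p (X \<omega>) \<partial>\<Omega>) \<le> upper_expectation a b m q p \<and>
          (\<exists>(\<Omega>' :: real measure) Y. (\<Omega>', Y) \<in> moment_rvs a b m q \<and>
             discrete_rv_at_most a b (m + 1) \<Omega>' Y \<and>
             (\<integral>\<omega>. poly p (Y \<omega>) \<partial>\<Omega>') = upper_expectation a b m q p) \<and>
          (\<exists>(\<Omega>' :: real measure) Y. (\<Omega>', Y) \<in> moment_rvs a b m q \<and>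
             discrete_rv_at_most a b (m + 1) \<Omega>' Y \<and>
             (\<integral>\<omega>. poly p (Y \<omega>) \<partial>\<Omega>') = lower_expectation a b m q p))"

proof (intro conjI allI impI)
  fix c :: "nat \<Rightarrow> real" and k
  assume "\<exists>\<epsilon>. admissible a b \<epsilon> \<and> (\<forall>j\<in>{1..m}. c j = \<epsilon> j)"
  \<comment> \<open>The measure that witnesses admissibility belongs to the class.\<close>
  then have ne: "moment_class a b m c \<noteq> {}"
    by (force simp: admissible_def moment_class_def)
  have cont: "continuous_on {a..b} (\<lambda>t. 1 / fact j * (b - t) ^ j)" for j
    by (intro continuous_intros)
  have h: "continuous_on {a..b} (\<lambda>t. (b - t) ^ k / fact k)"
    by (intro continuous_intros) simp
  show "\<exists>\<mu>\<in>moment_class a b m c. supported_on_at_most (m + 1) \<mu> \<and>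
      (\<integral>t. (b - t) ^ k / fact k \<partial>\<mu>) = M_plus a b m k c"
    using sup_attained[OF cont h] ne by (simp add: M_plus_def moment_class_eq)
  show "\<exists>\<mu>\<in>moment_class a b m c. supported_on_at_most (m + 1) \<mu> \<and>
      (\<integral>t. (b - t) ^ k / fact k \<partial>\<mu>) = M_minus a b m k c"
    using inf_attained[OF cont h] ne by (simp add: M_minus_def moment_class_eq)
next
  fix q :: "nat \<Rightarrow> real" and \<Omega> :: "'w measure" and X and p :: "real poly"
  assume X: "(\<Omega>, X) \<in> moment_rvs a b m q"
  let ?C = "constrained a b m (\<lambda>j t. t ^ j) q"
  have upper: "upper_expectation a b m q p = (SUP \<mu>\<in>?C. \<integral>t. poly p t \<partial>\<mu>)"
    and lower: "lower_expectation a b m q p = (INF \<mu>\<in>?C. \<integral>t. poly p t \<partial>\<mu>)"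
    by (simp_all only: upper_expectation_def lower_expectation_def moment_rvs_image)
  have cont: "continuous_on {a..b} (\<lambda>t. t ^ j)" for j :: nat by (intro continuous_intros)
  have p: "continuous_on {a..b} (poly p)" by (intro continuous_intros)
  \<comment> \<open>The law of \<open>X\<close> is a member of \<open>?C\<close>: this gives both
    bounds on the expectation and the nonemptiness required for attainment.\<close>
  note law = moment_rvs_distr[OF X]
  show "lower_expectation a b m q p \<le> (\<integral>\<omega>. poly p (X \<omega>) \<partial>\<Omega>)"
    unfolding lower law(2)[symmetric] by (intro cINF_lower law bdd_integrals p)
  show "(\<integral>\<omega>. poly p (X \<omega>) \<partial>\<Omega>) \<le> upper_expectation a b m q p"
    unfolding upper law(2)[symmetric] by (intro cSUP_upper law bdd_integrals p)
  have ne: "?C \<noteq> {}" using law(1) by blast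
  \<comment> \<open>The witness is an optimal discrete measure as sample space with the identity as
    random variable; likewise for the lower bound.\<close>
  show "\<exists>(\<Omega>' :: real measure) Y. (\<Omega>', Y) \<in> moment_rvs a b m q \<and>
      discrete_rv_at_most a b (m + 1) \<Omega>' Y \<and>
      (\<integral>\<omega>. poly p (Y \<omega>) \<partial>\<Omega>') = upper_expectation a b m q p"
    using sup_attained[OF cont p ne] identity_moment_rv unfolding upper by blast
  show "\<exists>(\<Omega>' :: real measure) Y. (\<Omega>', Y) \<in> moment_rvs a b m q \<and>
      discrete_rv_at_most a b (m + 1) \<Omega>' Y \<and>
      (\<integral>\<omega>. poly p (Y \<omega>) \<partial>\<Omega>') = lower_expectation a b m q p"
    using inf_attained[OF cont p ne] identity_moment_rv unfolding lower by blast
qed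

end
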